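(* Let $\mathcal X=\prod_{i\in[n]}\mathcal X_i$ be finite, let $f:\mathcal X\to\mathcal Y$ have range $\mathcal Y$ with $|\mathcal Y|=k$, let $d:\mathcal Y\times\mathcal Y\to[0,\infty)$ be a distortion function, and let $p(y|x)$ be the (discrete) exponential privacy channel of $f$ with parameter $N>0$. Put $\lambda=1/N$. If $$\log\frac{1-\exp(-k\lambda)}{1-\exp(-\lambda)}+\frac{\lambda}{\exp(\lambda)-1}-\frac{k\lambda}{\exp(k\lambda)-1}\ \ge\ \log k-\epsilon,$$ then the exponential privacy channel satisfies $\epsilon$-information privacy with respect to $\mathbb P$.
   Context: $n\ge1$, $[n]=\{1,\dots,n\}$; $\mathcal X_1,\dots,\mathcal X_n$ are finite nonempty sets. All logarithms (including those in mutual information) are natural. Exponential privacy channel: write $\mathcal Y=\{y_1,\dots,y_k\}$. For each $x\in\mathcal X$ choose a permutation $(i_1,\dots,i_k)$ of $[k]$ with $d(y_{i_1},f(x))\le d(y_{i_2},f(x))\le\cdots\le d(y_{i_k},f(x))$ and set $\phi_x(y_{i_j})=j-1$ for $j\in[k]$. The channel with parameter $N>0$ is $$p(y|x)=\frac1\alpha\exp\left(\frac{-\phi_x(y)}{N}\right),\quad y\in\mathcal Y,\qquad \alpha=\sum_{i=0}^{k-1}\exp\left(\frac{-i}{N}\right).$$ $\mathbb P$ is the set of all probability distributions on $\mathcal X$. For $X=(X_1,\dots,X_n)$ with distribution in $\mathbb P$, $Y$ denotes the output of the channel on input $X$. The individual channel capacity with respect to $\mathbb P$ is $C_1=\max_{i\in[n],X\in\mathbb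 P}I(X_i;Y)$, where $I$ is mutual information. The channel satisfies $\epsilon$-information privacy with respect to $\mathbb P$ if $C_1\le\epsilon$. *)

theory Defs
  imports "HOL-Probability.Probability"
begin

text \<open>
  Inputs are tuples \<open>x = (x i)\<close> with \<open>i \<in> {1..n}\<close>, i.e. elements of
  \<^term>\<open>PiE {1..n} Xs\<close>; the components may be taken in one common type, since the
  alphabets \<open>Xs i\<close> are arbitrary finite subsets of it. A channel is a function \<open>p\<close>
  with \<open>p x y\<close> standing for \<open>p(y|x)\<close>.
\<close>

definition distributions :: "'x set \<Rightarrow> 'x pmf set" where
  "distributions X = {P. set_pmf P \<subseteq> X}"

text \<open>The joint law, on \<^term>\<open>X \<times> Y\<close>, of an input with law \<open>P\<close> and the output of \<open>p\<close>.\<close>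

definition joint_law :: "'x set \<Rightarrow> 'y set \<Rightarrow> ('x \<Rightarrow> 'y \<Rightarrow> real) \<Rightarrow> 'x pmf \<Rightarrow> ('x \<times> 'y) measure" where
  "joint_law X Y p P = point_measure (X \<times> Y) (\<lambda>(x, y). ennreal (pmf P x * p x y))"

lemma prob_space_joint_law:
  assumes "finite X" "finite Y" "P \<in> distributions X"
    and "\<And>x y. x \<in> X \<Longrightarrow> y \<in> Y \<Longrightarrow> 0 \<le> p x y"
    and "\<And>x. x \<in> X \<Longrightarrow> (\<Sum>y\<in>Y. p x y) = 1"
  shows "prob_space (joint_law X Y p P)"
proof -
  have "(\<Sum>z\<in>X \<times> Y. ennreal (case z of (x, y) \<Rightarrow> pmf P x * p x y))
      = ennreal (\<Sum>z\<in>X \<times> Y. case z of (x, y) \<Rightarrow> pmf P x * p x y)"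
    using assms(4) by (intro sum_ennreal) auto
  also have "(\<Sum>z\<in>X \<times> Y. case z of (x, y) \<Rightarrow> pmf P x * p x y) = (\<Sum>x\<in>X. \<Sum>y\<in>Y. pmf P x * p x y)"
    by (simp add: sum.cartesian_product)
  also have "\<dots> = (\<Sum>x\<in>X. pmf P x)"
    using assms(5) by (simp flip: sum_distrib_left)
  also have "\<dots> = 1"
    using assms(1,3) by (intro sum_pmf_eq_1) (auto simp: distributions_def)
  finally show ?thesis
    unfolding joint_law_def using assms(1,2)
    by (intro prob_spaceI) (simp add: space_point_measure emeasure_point_measure_finite case_prod_unfold)
qed

text \<open>\<open>I(X\<^sub>i; Y)\<close> in nats: the library's mutual information to base \<open>e\<close>.\<close>

definition input_output_information ::
  "(nat \<Rightarrow> 'a) set \<Rightarrow> 'y set \<Rightarrow> ((nat \<Rightarrow> 'a) \<Rightarrow> 'y \<Rightarrow> real) \<Rightarrow> (nat \<Rightarrow> 'a) pmf \<Rightarrow> nat \<Rightarrow> real" where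
  "input_output_information X Y p P i =
    (let M = joint_law X Y p P; Xi = (\<lambda>(x, y). x i); Yo = (\<lambda>(x, y). y)
     in prob_space.mutual_information M (exp 1)
          (count_space (Xi ` space M)) (count_space (Yo ` space M)) Xi Yo)"

text \<open>
  The maximum is rendered as a supremum. Mutual information on finite alphabets is bounded
  and continuous in the input law, so for a channel this supremum is attained.
\<close>

definition individual_capacity ::
  "nat \<Rightarrow> (nat \<Rightarrow> 'a set) \<Rightarrow> 'y set \<Rightarrow> ((nat \<Rightarrow> 'a) \<Rightarrow> 'y \<Rightarrow> real) \<Rightarrow> real" where
  "individual_capacity n Xs Y p =
    (SUP (i, P) \<in> {1..n} \<times> distributions (PiE {1..n} Xs).
       input_output_information (PiE {1..n} Xs) Y p P i)"

definition information_privacy ::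
  "nat \<Rightarrow> (nat \<Rightarrow> 'a set) \<Rightarrow> 'y set \<Rightarrow> ((nat \<Rightarrow> 'a) \<Rightarrow> 'y \<Rightarrow> real) \<Rightarrow> real \<Rightarrow> bool" where
  "information_privacy n Xs Y p \<epsilon> \<longleftrightarrow> individual_capacity n Xs Y p \<le> \<epsilon>"

text \<open>
  Here \<open>e j\<close> is the element \<open>y\<^bsub>i\<^sub>j\<^esub>\<close> of a reordering of \<open>Y\<close> by nondecreasing distance
  to \<open>z\<close>; ties may be broken arbitrarily, so the ranking \<open>r\<close> is not determined by \<open>d\<close> and \<open>z\<close>.
\<close>

definition distance_ranking :: "'y set \<Rightarrow> ('y \<Rightarrow> 'y \<Rightarrow> real) \<Rightarrow> 'y \<Rightarrow> ('y \<Rightarrow> nat) \<Rightarrow> bool" where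
  "distance_ranking Y d z r \<longleftrightarrow>
    (\<exists>e. bij_betw e {1..card Y} Y \<and>
         (\<forall>j\<in>{1..card Y}. \<forall>l\<in>{1..card Y}. j \<le> l \<longrightarrow> d (e j) z \<le> d (e l) z) \<and>
         (\<forall>j\<in>{1..card Y}. r (e j) = j - 1))"

definition exponential_privacy_channel ::
  "'x set \<Rightarrow> 'y set \<Rightarrow> ('x \<Rightarrow> 'y) \<Rightarrow> ('y \<Rightarrow> 'y \<Rightarrow> real) \<Rightarrow> real \<Rightarrow> ('x \<Rightarrow> 'y \<Rightarrow> real) \<Rightarrow> bool" where
  "exponential_privacy_channel X Y f d N p \<longleftrightarrow>
    (\<exists>\<phi>. (\<forall>x\<in>X. distance_ranking Y d (f x) (\<phi> x)) \<and>
         (\<forall>x\<in>X. \<forall>y\<in>Y. p x y =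
            1 / (\<Sum>i = 0..card Y - 1. exp (- real i / N)) * exp (- real (\<phi> x y) / N)))"

end

theory Submission
  imports Defs
begin

text \<open>
  Every row of the channel is a reordering of the same truncated geometric law, whose entropy
  \<open>H\<close> is the left-hand side of the hypothesis. Since \<open>H(Y)\<close> is at most
  \<open>ln k\<close> and \<open>H(Y | X\<^sub>i)\<close> is at least \<open>H(Y | X) = H\<close>, every
  \<open>I(X\<^sub>i; Y)\<close> is at most \<open>ln k - H\<close>. Both entropy bounds come at once from
  a single application of \<open>ln t \<le> t - 1\<close>, with \<open>t\<close> the ratio of
  \<open>P(x\<^sub>i, y)\<close> to \<open>P(x\<^sub>i) P(y) k p(y|x)\<close>.
\<close>

lemma sum_index_mult_power:
  fixes r :: "'a::comm_ring_1"
  shows "(\<Sum>j<k. of_nat j * r ^ j) * (1 - r) = r * (\<Sum>j<k. r ^ j) - of_nat k * r ^ k"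
proof (induction k)
  case (Suc k)
  then show ?case
    by (simp only: sum.lessThan_Suc distrib_right) (simp add: algebra_simps)
qed simp

text \<open>The right-hand side is ln k - H(Y | X), with the conditional entropy written as an
  average over the rows. The rows may differ arbitrarily here; that they share one entropy enters
  only in the theorem.\<close>

lemma input_output_information_le:
  fixes X :: "(nat \<Rightarrow> 'a) set" and Y :: "'y set"
  assumes fin: "finite X" "finite Y"
    and P: "P \<in> distributions X"
    and pos: "\<And>x y. x \<in> X \<Longrightarrow> y \<in> Y \<Longrightarrow> 0 < p x y"
    and row: "\<And>x. x \<in> X \<Longrightarrow> (\<Sum>y\<in>Y. p x y) = 1"
  shows "input_output_information X Y p P i
    \<le> ln (real (card Y)) + (\<Sum>x\<in>X. pmf P x * (\<Sum>y\<in>Y. p x y * ln (p x y)))"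
proof -
  let ?M = "joint_law X Y p P"
  let ?Xi = "\<lambda>(x, y). x i"
  let ?Yo = "\<lambda>(x, y). y"
  \<comment> \<open>\<open>w\<close> is the joint law of (X, Y), \<open>qa\<close> and
    \<open>qy\<close> are the marginals of X_i and Y, and \<open>q\<close> is the joint law of (X_i,
    Y).\<close>
  define w where "w x y = pmf P x * p x y" for x y
  define qa where "qa a = (\<Sum>x | x \<in> X \<and> x i = a. pmf P x)" for a
  define qy where "qy y = (\<Sum>x\<in>X. w x y)" for y
  define q where "q a y = (\<Sum>x | x \<in> X \<and> x i = a. w x y)" for a y
  have prob: "prob_space ?M"
    using fin P pos row by (intro prob_space_joint_law) (auto intro: less_imp_le)
  interpret information_space ?M "exp 1"
    using prob by (simp add: information_space_def information_space_axioms_def)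
  have space: "space ?M = X \<times> Y"
    by (simp add: joint_law_def space_point_measure)
  have sets: "sets ?M = Pow (X \<times> Y)"
    by (simp add: joint_law_def sets_point_measure)
  have w_nonneg: "0 \<le> w x y" if "x \<in> X" "y \<in> Y" for x y
    using pos[OF that] by (simp add: w_def)
  have sumP: "(\<Sum>x\<in>X. pmf P x) = 1"
    using fin P by (intro sum_pmf_eq_1) (auto simp: distributions_def)
  have meas: "measure ?M A = (\<Sum>(x, y)\<in>A. w x y)" if "A \<subseteq> X \<times> Y" for A
    using measure_point_measure_finite_if[of "X \<times> Y" "\<lambda>z. w (fst z) (snd z)" A] fin that w_nonneg
    by (auto simp: joint_law_def w_def case_prod_unfold)
  have meas_q: "measure ?M ((\<lambda>z. (?Xi z, ?Yo z)) -` {(a, y)} \<inter> space ?M) = q a y" if "y \<in> Y" for a y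
  proof -
    have "(\<lambda>z. (?Xi z, ?Yo z)) -` {(a, y)} \<inter> space ?M = {x \<in> X. x i = a} \<times> {y}"
      using that by (auto simp: space)
    then show ?thesis
      using that by (subst meas) (auto simp: space q_def sum.cartesian_product[symmetric])
  qed
  have meas_qa: "measure ?M (?Xi -` {a} \<inter> space ?M) = qa a" for a
  proof -
    have "?Xi -` {a} \<inter> space ?M = {x \<in> X. x i = a} \<times> Y"
      by (auto simp: space)
    then show ?thesis
      using row by (subst meas)
        (auto simp: space qa_def w_def sum.cartesian_product[symmetric] simp flip: sum_distrib_left)
  qed
  have meas_qy: "measure ?M (?Yo -` {y} \<inter> space ?M) = qy y" if "y \<in> Y" for y
  proof -
    have "?Yo -` {y} \<inter> space ?M = X \<times> {y}"
      using that by (auto simp: space)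
    then show ?thesis
      using that by (subst meas) (auto simp: space qy_def sum.cartesian_product[symmetric])
  qed
  \<comment> \<open>The space is finite and every subset is measurable, so the finite-sum formula
    for mutual information applies to all three variables.\<close>
  have simple: "simple_function ?M g" for g :: "_ \<Rightarrow> 'c"
    using fin by (auto simp: simple_function_def space sets)
  have nonempty: "X \<noteq> {}" "Y \<noteq> {}"
    using not_empty by (auto simp: space)
  have qy_pos: "0 < qy y" if "y \<in> Y" for y
  proof -
    obtain x where "x \<in> X" "0 < pmf P x"
      using sumP by (metis pmf_nonneg less_eq_real_def sum.neutral zero_neq_one)
    with that fin w_nonneg pos show ?thesis
      unfolding qy_def by (intro sum_pos2[of _ x]) (auto simp: w_def)
  qed
  have q_pos: "0 < q (x i) y" "0 < qa (x i)" if "x \<in> X" "y \<in> Y" "0 < pmf P x" for x y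
    using that fin w_nonneg pos unfolding q_def qa_def
    by (auto intro!: sum_pos2[of _ x] simp: w_def)
  have img: "(\<lambda>z. (?Xi z, ?Yo z)) ` space ?M = (\<lambda>x. x i) ` X \<times> Y"
    by (force simp: space)

  have "input_output_information X Y p P i = mutual_information_Pow ?Xi ?Yo"
    by (simp add: input_output_information_def Let_def)
  also have "\<dots> = (\<Sum>(a, y)\<in>(\<lambda>x. x i) ` X \<times> Y. q a y * ln (q a y / (qa a * qy y)))"
    unfolding mutual_information_simple_distributed[OF simple_distributedI[OF simple measure_nonneg refl]
        simple_distributedI[OF simple measure_nonneg refl]
        simple_distributedI[OF simple measure_nonneg refl]] img
    by (intro sum.cong) (auto simp: meas_q meas_qa meas_qy log_def)
  also have "\<dots> = (\<Sum>y\<in>Y. \<Sum>a\<in>(\<lambda>x. x i) ` X. q a y * ln (q a y / (qa a * qy y)))"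
    by (subst sum.swap) (simp add: sum.cartesian_product)
  \<comment> \<open>Unfolding \<open>q a y\<close> as a sum over the fibre \<open>x i = a\<close>,
    on which the logarithm is constant, turns the sum over values of X_i into one over
    inputs.\<close>
  also have "\<dots> = (\<Sum>y\<in>Y. \<Sum>x\<in>X. w x y * ln (q (x i) y / (qa (x i) * qy y)))"
  proof (rule sum.cong)
    fix y
    show "(\<Sum>a\<in>(\<lambda>x. x i) ` X. q a y * ln (q a y / (qa a * qy y)))
        = (\<Sum>x\<in>X. w x y * ln (q (x i) y / (qa (x i) * qy y)))"
      unfolding sum.image_gen[OF fin(1), of "\<lambda>x. w x y * _ x" "\<lambda>x. x i"]
      by (auto simp: q_def sum_distrib_right intro!: sum.cong)
  qed simp
  \<comment> \<open>Gibbs' inequality against the reference law that draws y uniformly, then x_i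
    given y, then x given x_i: its mass at (x, y) is the fraction in the last bracket.\<close>
  also have "\<dots> \<le> (\<Sum>y\<in>Y. \<Sum>x\<in>X. w x y * ln (card Y) + w x y * ln (p x y)
      + (pmf P x * q (x i) y / (qa (x i) * qy y * card Y) - w x y))"
  proof (intro sum_mono)
    fix x y assume xy: "y \<in> Y" "x \<in> X"
    show "w x y * ln (q (x i) y / (qa (x i) * qy y)) \<le> w x y * ln (card Y) + w x y * ln (p x y)
      + (pmf P x * q (x i) y / (qa (x i) * qy y * card Y) - w x y)"
    proof (cases "pmf P x = 0")
      \<comment> \<open>Inputs of mass 0 contribute 0 to both sides, so a vanishing
        \<open>qa (x i)\<close> in a denominator is harmless.\<close>
      case True
      then show ?thesis by (simp add: w_def)
    next
      case False
      then have P_pos: "0 < pmf P x" by (simp add: pmf_pos)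
      have c_pos: "0 < real (card Y)"
        using fin nonempty by (simp add: card_gt_0_iff)
      note pos' = q_pos[OF xy(2,1) P_pos] qy_pos[OF xy(1)] pos[OF xy(2,1)] c_pos
      \<comment> \<open>The factor \<open>p x y\<close> in the denominator cancels against
        \<open>w x y\<close>, so that \<open>w x y * t\<close> is the reference mass.\<close>
      define t where "t = q (x i) y / (qa (x i) * qy y * card Y * p x y)"
      have t_pos: "0 < t" using pos' by (simp add: t_def)
      have "q (x i) y / (qa (x i) * qy y) = card Y * p x y * t"
        using pos' by (simp add: t_def field_simps)
      then have "ln (q (x i) y / (qa (x i) * qy y)) = ln (card Y) + ln (p x y) + ln t"
        using pos' t_pos by (simp add: ln_mult)
      also have "\<dots> \<le> ln (card Y) + ln (p x y) + (t - 1)"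
        using ln_le_minus_one[OF t_pos] by simp
      finally have "w x y * ln (q (x i) y / (qa (x i) * qy y))
          \<le> w x y * (ln (card Y) + ln (p x y) + (t - 1))"
        using w_nonneg[OF xy(2,1)] by (rule mult_left_mono)
      moreover have "w x y * t = pmf P x * q (x i) y / (qa (x i) * qy y * card Y)"
        using pos' by (simp add: t_def w_def)
      ultimately show ?thesis by (simp add: algebra_simps)
    qed
  qed
  also have "\<dots> = ln (card Y) * (\<Sum>y\<in>Y. \<Sum>x\<in>X. w x y) + (\<Sum>y\<in>Y. \<Sum>x\<in>X. w x y * ln (p x y))
      + (\<Sum>y\<in>Y. \<Sum>x\<in>X. pmf P x * q (x i) y / (qa (x i) * qy y * card Y))
      - (\<Sum>y\<in>Y. \<Sum>x\<in>X. w x y)"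
    by (simp add: sum.distrib sum_subtractf sum_distrib_left mult.commute)
  also have "(\<Sum>y\<in>Y. \<Sum>x\<in>X. w x y) = 1"
    using row sumP by (subst sum.swap) (simp add: w_def flip: sum_distrib_left)
  also have "(\<Sum>y\<in>Y. \<Sum>x\<in>X. w x y * ln (p x y)) = (\<Sum>x\<in>X. pmf P x * (\<Sum>y\<in>Y. p x y * ln (p x y)))"
    by (subst sum.swap) (simp add: w_def sum_distrib_left mult.assoc)
  \<comment> \<open>The reference law has total mass at most 1: for each y, grouping the inputs by
    x_i cancels \<open>qa\<close>, and then the sum of \<open>q a y\<close> over a cancels
    \<open>qy y\<close>, leaving 1/k.\<close>
  also have "(\<Sum>y\<in>Y. \<Sum>x\<in>X. pmf P x * q (x i) y / (qa (x i) * qy y * card Y)) \<le> 1"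
  proof -
    have "(\<Sum>x\<in>X. pmf P x * q (x i) y / (qa (x i) * qy y * card Y)) \<le> 1 / card Y" if y: "y \<in> Y" for y
    proof -
      have "(\<Sum>x\<in>X. pmf P x * q (x i) y / (qa (x i) * qy y * card Y))
          = (\<Sum>a\<in>(\<lambda>x. x i) ` X. qa a * q a y / (qa a * qy y * card Y))"
        using fin by (subst sum.image_gen[where g = "\<lambda>x. x i"])
          (auto simp: qa_def sum_distrib_right sum_divide_distrib intro!: sum.cong)
      \<comment> \<open>An inequality covers both cases: if \<open>qa a = 0\<close> the left term is
        0 and the right one is nonnegative; otherwise the factor cancels.\<close>
      also have "\<dots> \<le> (\<Sum>a\<in>(\<lambda>x. x i) ` X. q a y / (qy y * card Y))"
        using y w_nonneg qy_pos[OF y]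
        by (intro sum_mono) (auto simp: q_def intro!: sum_nonneg divide_nonneg_nonneg)
      also have "\<dots> = (\<Sum>a\<in>(\<lambda>x. x i) ` X. q a y) / (qy y * card Y)"
        by (simp add: sum_divide_distrib)
      also have "(\<Sum>a\<in>(\<lambda>x. x i) ` X. q a y) = qy y"
        unfolding q_def qy_def by (rule sum.image_gen[OF fin(1), symmetric])
      finally show ?thesis using qy_pos[OF y] by simp
    qed
    then have "(\<Sum>y\<in>Y. \<Sum>x\<in>X. pmf P x * q (x i) y / (qa (x i) * qy y * card Y))
        \<le> (\<Sum>y\<in>Y. 1 / card Y)"
      by (rule sum_mono)
    also have "\<dots> = 1" using fin nonempty by simp
    finally show ?thesis .
  qed
  finally show ?thesis by simp
qed

text \<open>The logarithm of the j-th weight is \<open>- lam * j - ln \<alpha>\<close>, so the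
  negative entropy is minus \<open>lam\<close> times the mean, minus \<open>ln \<alpha>\<close>. The
  closed forms of the geometric sum and of the mean then give the three terms.\<close>

lemma truncated_geometric_entropy:
  fixes lam :: real
  assumes "0 < lam" "0 < k"
  defines "\<alpha> \<equiv> \<Sum>j<k. exp (- real j * lam)"
  shows "(\<Sum>j<k. exp (- real j * lam) / \<alpha> * ln (exp (- real j * lam) / \<alpha>))
    = - (ln ((1 - exp (- (real k * lam))) / (1 - exp (- lam))) + lam / (exp lam - 1)
           - real k * lam / (exp (real k * lam) - 1))"
proof -
  define r where "r = exp (- lam)"
  have r: "0 < r" "r < 1" using assms by (auto simp: r_def)
  have pow: "exp (- real j * lam) = r ^ j" for j
    by (simp add: r_def exp_of_nat_mult[symmetric])
  have rk: "r ^ k < 1" using r assms by (simp add: power_less_one_iff)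
  have \<alpha>: "\<alpha> = (1 - r ^ k) / (1 - r)"
    using r unfolding \<alpha>_def pow by (simp add: sum_gp_strict)
  have \<alpha>_pos: "0 < \<alpha>" using r rk by (simp add: \<alpha>)
  have mean: "(\<Sum>j<k. real j * r ^ j) / \<alpha> = r / (1 - r) - real k * r ^ k / (1 - r ^ k)"
  proof -
    have "(\<Sum>j<k. real j * r ^ j) * (1 - r) = r * \<alpha> - real k * r ^ k"
      using sum_index_mult_power[of r k] by (simp only: \<alpha>_def pow)
    then have "(\<Sum>j<k. real j * r ^ j) = (r * \<alpha> - real k * r ^ k) / (1 - r)"
      using r by (simp add: field_simps)
    then have "(\<Sum>j<k. real j * r ^ j) / \<alpha> = r / (1 - r) - real k * r ^ k / (\<alpha> * (1 - r))"
      using \<alpha>_pos by (simp add: diff_divide_distrib mult.commute)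
    also have "\<alpha> * (1 - r) = 1 - r ^ k" using r by (simp add: \<alpha>)
    finally show ?thesis .
  qed
  have "(\<Sum>j<k. exp (- real j * lam) / \<alpha> * ln (exp (- real j * lam) / \<alpha>))
      = (\<Sum>j<k. - (lam * (real j * r ^ j / \<alpha>)) - ln \<alpha> * (r ^ j / \<alpha>))"
    using \<alpha>_pos by (intro sum.cong) (simp_all add: ln_div algebra_simps diff_divide_distrib flip: pow)
  also have "\<dots> = - (lam * ((\<Sum>j<k. real j * r ^ j) / \<alpha>)) - ln \<alpha> * ((\<Sum>j<k. r ^ j) / \<alpha>)"
    by (simp add: sum_subtractf sum_negf sum_distrib_left sum_divide_distrib)
  also have "(\<Sum>j<k. r ^ j) / \<alpha> = 1" using \<alpha>_pos by (simp add: \<alpha>_def flip: pow)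
  \<comment> \<open>Both fractions in \<open>mean\<close> are rewritten by clearing the negative
    exponentials from numerator and denominator.\<close>
  also have "(\<Sum>j<k. real j * r ^ j) / \<alpha> = 1 / (exp lam - 1) - real k / (exp (real k * lam) - 1)"
  proof -
    have "r / (1 - r) = 1 / (exp lam - 1)"
      using r by (simp add: r_def exp_minus field_simps)
    moreover have "r ^ k / (1 - r ^ k) = 1 / (exp (real k * lam) - 1)"
      using rk by (simp add: pow[symmetric] exp_minus field_simps)
    ultimately show ?thesis
      unfolding mean by (metis times_divide_eq_right mult.right_neutral)
  qed
  finally show ?thesis
    using pow[of k] by (simp add: \<alpha> r_def[symmetric] right_diff_distrib mult.commute mult.left_commute)
qed

theorem mainTheorem5:
  fixes n k :: nat
    and Xs :: "nat \<Rightarrow> 'a set"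
    and Y :: "'y set"
    and f :: "(nat \<Rightarrow> 'a) \<Rightarrow> 'y"
    and d :: "'y \<Rightarrow> 'y \<Rightarrow> real"
    and p :: "(nat \<Rightarrow> 'a) \<Rightarrow> 'y \<Rightarrow> real"
    and N lam \<epsilon> :: real
  assumes "n \<ge> 1"
    and "\<And>i. i \<in> {1..n} \<Longrightarrow> finite (Xs i) \<and> Xs i \<noteq> {}"
    and "f ` PiE {1..n} Xs = Y"
    and "card Y = k"
    and "\<And>y z. y \<in> Y \<Longrightarrow> z \<in> Y \<Longrightarrow> 0 \<le> d y z"
    and "N > 0"
    and "exponential_privacy_channel (PiE {1..n} Xs) Y f d N p"
    and "lam = 1 / N"
    and "ln ((1 - exp (- (real k * lam))) / (1 - exp (- lam))) + lam / (exp lam - 1)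
           - real k * lam / (exp (real k * lam) - 1) \<ge> ln (real k) - \<epsilon>"
  shows "information_privacy n Xs Y p \<epsilon>"
proof -
  let ?X = "PiE {1..n} Xs"
  let ?q = "\<lambda>j. exp (- real j * lam) / (\<Sum>j<k. exp (- real j * lam))"
  have fin: "finite ?X" "finite Y"
    using assms(2) by (auto simp: assms(3)[symmetric] intro!: finite_PiE)
  have ne: "?X \<noteq> {}" using assms(2) by (auto simp: PiE_eq_empty_iff)
  then have k: "0 < k" using fin assms(3,4) by (auto simp: card_gt_0_iff)
  obtain \<phi> where \<phi>: "\<And>x. x \<in> ?X \<Longrightarrow> distance_ranking Y d (f x) (\<phi> x)"
    and p: "\<And>x y. x \<in> ?X \<Longrightarrow> y \<in> Y \<Longrightarrow>
      p x y = 1 / (\<Sum>i = 0..card Y - 1. exp (- real i / N)) * exp (- real (\<phi> x y) / N)"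
    using assms(7) unfolding exponential_privacy_channel_def by blast
  \<comment> \<open>Since k > 0, the truncated subtraction in \<open>{0..card Y - 1}\<close> is
    exact and the range is \<open>{..<k}\<close>.\<close>
  have p_eq: "p x y = ?q (\<phi> x y)" if "x \<in> ?X" "y \<in> Y" for x y
  proof -
    have "{0..card Y - 1} = {..<k}" using k assms(4) by auto
    then show ?thesis using p[OF that] assms(8) by simp
  qed
  have \<alpha>_pos: "0 < (\<Sum>j<k. exp (- real j * lam))"
    using k by (intro sum_pos) auto
  \<comment> \<open>However ties are broken, a ranking is a bijection onto {0, ..., k - 1}, so a sum
    over a row does not depend on x. The function \<open>g\<close> is left free: the identity gives
    normalization, and t ln t gives the entropy.\<close>
  have row: "(\<Sum>y\<in>Y. g (p x y)) = (\<Sum>j<k. g (?q j))" if x: "x \<in> ?X" for x and g :: "real \<Rightarrow> real"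
  proof -
    obtain e where e: "bij_betw e {1..k} Y" "\<And>j. j \<in> {1..k} \<Longrightarrow> \<phi> x (e j) = j - 1"
      using \<phi>[OF x] assms(4) unfolding distance_ranking_def by blast
    have "(\<Sum>y\<in>Y. g (p x y)) = (\<Sum>y\<in>Y. g (?q (\<phi> x y)))"
      using x by (simp add: p_eq)
    also have "\<dots> = (\<Sum>j = 1..k. g (?q (j - 1)))"
      using e by (subst sum.reindex_bij_betw[OF e(1), symmetric]) simp
    \<comment> \<open>The enumeration \<open>e\<close> starts at 1 but ranks start at 0, hence the
      shift by \<open>Suc\<close>.\<close>
    also have "\<dots> = (\<Sum>j<k. g (?q j))"
      by (rule sum.reindex_bij_witness[of _ Suc "\<lambda>j. j - 1"]) auto
    finally show ?thesis .
  qed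
  have bound: "input_output_information ?X Y p P i \<le> \<epsilon>" if P: "P \<in> distributions ?X" for P i
  proof -
    let ?negH = "\<Sum>j<k. ?q j * ln (?q j)"
    have "input_output_information ?X Y p P i
        \<le> ln (real (card Y)) + (\<Sum>x\<in>?X. pmf P x * (\<Sum>y\<in>Y. p x y * ln (p x y)))"
    proof (rule input_output_information_le[OF fin P])
      show "0 < p x y" if "x \<in> ?X" "y \<in> Y" for x y
        using \<alpha>_pos by (simp add: p_eq[OF that])
      show "(\<Sum>y\<in>Y. p x y) = 1" if "x \<in> ?X" for x
        using row[OF that, of "\<lambda>t. t"] \<alpha>_pos by (simp flip: sum_divide_distrib)
    qed
    also have "(\<Sum>x\<in>?X. pmf P x * (\<Sum>y\<in>Y. p x y * ln (p x y))) = (\<Sum>x\<in>?X. pmf P x * ?negH)"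
      by (intro sum.cong refl) (subst row[where g = "\<lambda>t. t * ln t"], auto)
    also have "\<dots> = (\<Sum>x\<in>?X. pmf P x) * ?negH"
      by (rule sum_distrib_right[symmetric])
    also have "(\<Sum>x\<in>?X. pmf P x) = 1"
      using fin P by (intro sum_pmf_eq_1) (auto simp: distributions_def)
    finally show ?thesis
      using truncated_geometric_entropy[of lam k] k assms(4,6,8,9) by simp
  qed
  \<comment> \<open>A point mass shows that the supremum ranges over a nonempty set, so that a bound
    on every member bounds it.\<close>
  obtain x where "x \<in> ?X" using ne by blast
  then have "return_pmf x \<in> distributions ?X" by (simp add: distributions_def)
  then show ?thesis
    unfolding information_privacy_def individual_capacity_def
    using assms(1) bound by (intro cSUP_least) auto
qed

end
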